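(* Let $t$ be an odd prime, $N$ a non-negative integer, $k$ an integer, and $\nu\in\{0,1,2,\ldots,t-1\}$. Let $$GSC_{tN+\nu,t}(k,q) := \sum_{\substack{\pi\in\mathcal{SCP}\\ \mathrm{GBG}^{(t)}(\pi)=k\\ l(\pi)\le tN+\nu}} q^{|\pi|}$$ be the generating function for self-conjugate partitions with all parts at most $tN+\nu$ and GBG-rank mod $t$ equal to $k$. Then $$GSC_{tN+\nu,t}(k,q) = q^{tk^2-(t-1)k}\,(-q^t;q^{2t})_{N+\left\lceil\frac{\nu-\frac{t-1}{2}}{t}\right\rceil}\left[\begin{matrix}2N+\lceil\frac{\nu}{t}\rceil\\ N+k\end{matrix}\right]_{q^{2t}}\prod_{i=1}^{\frac{t-3}{2}}\left[\begin{matrix}2N+\lceil\frac{\nu-i}{t}\rceil+\lfloor\frac{\nu+i}{t}\rfloor\\ N+\lfloor\frac{\nu+i}{t}\rfloor\end{matrix}\right]_{q^{2t}}.$$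
   Context: A partition is a non-increasing finite sequence $\pi=(\lambda_1,\lambda_2,\ldots)$ of positive integers (its parts); the empty partition is included. $|\pi|=\sum_i\lambda_i$ is its norm, and $l(\pi)$ is its largest part ($0$ for the empty partition). The Young diagram of $\pi$ has $\lambda_i$ cells in row $i$, left-justified. The conjugate $\pi'$ is the partition whose Young diagram is the reflection of that of $\pi$ across the main diagonal; $\pi$ is self-conjugate if $\pi=\pi'$, and $\mathcal{SCP}$ is the set of all self-conjugate partitions. The cell in row $i$ and column $j$ ($i,j\ge1$) of the Young diagram is labeled by the least non-negative integer congruent to $j-i$ modulo $t$. For $0\le s\le t-1$, $r_s(\pi,t)$ is the number of cells of $\pi$ labeled $s$. With $\omega_t=e^{2\pi\sqrt{-1}/t}$, the GBG-rank of $\pi$ mod $t$ is the complex number $\mathrm{GBG}^{(t)}(\pi)=\sum_{s=0}^{t-1} r_s(\pi,t)\,\omega_t^s$. For $L\ge0$, $(a;q)_L=\prod_{m=0}^{L-1}(1-aq^m)$, so that $(-q^t;q^{2t})_L=\prod_{m=0}^{L-1}(1+q^{t+2tm})$. The $q$-binomial coefficient is $\left[\begin{matrix}m\\ n\end{matrix}\right]_q=\frac{(q;q)_m}{(q;q)_n(q;q)_{m-n}}$ for $m\ge n\ge0$ and $0$ otherwise; the subscript $q^{2t}$ means $q$ is replaced by $q^{2t}$. $\lfloor x\rfloor$ is the greatest integer $\le x$ and $\lceil x\rceil$ the least integer $\ge x$. An empty product (as occurs for $t=3$) equals $1$. *)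

theory Defs
  imports Complex_Main "HOL-Computational_Algebra.Primes"
    "HOL-Computational_Algebra.Formal_Power_Series"
begin

section \<open>Partitions and Young diagrams\<close>

definition is_partition :: "nat list \<Rightarrow> bool" where
  "is_partition p \<longleftrightarrow> sorted_wrt (\<ge>) p \<and> (\<forall>x\<in>set p. x > 0)"

definition largest_part :: "nat list \<Rightarrow> nat" where
  "largest_part p = Max (insert 0 (set p))"

text \<open>Cells are pairs (row, column), both counted from 1, whereas list positions start at 0.\<close>

definition young_diagram :: "nat list \<Rightarrow> (nat \<times> nat) set" where
  "young_diagram p = {(i, j). 1 \<le> i \<and> i \<le> length p \<and> 1 \<le> j \<and> j \<le> p ! (i - 1)}"

definition conjugate :: "nat list \<Rightarrow> nat list" where
  "conjugate p =
     (THE p'. is_partition p' \<and> young_diagram p' = prod.swap ` young_diagram p)"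

definition self_conjugate_partitions :: "nat list set" where
  "self_conjugate_partitions = {p. is_partition p \<and> conjugate p = p}"

section \<open>GBG-rank\<close>

definition cell_label :: "nat \<Rightarrow> nat \<times> nat \<Rightarrow> nat" where
  "cell_label t c = nat ((int (snd c) - int (fst c)) mod int t)"

definition label_count :: "nat \<Rightarrow> nat list \<Rightarrow> nat \<Rightarrow> nat" where
  "label_count t p s = card {c \<in> young_diagram p. cell_label t c = s}"

definition gbg_rank :: "nat \<Rightarrow> nat list \<Rightarrow> complex" where
  "gbg_rank t p =
     (\<Sum>s = 0..t - 1. of_nat (label_count t p s) * exp (2 * of_real pi * \<i> / of_nat t) ^ s)"

section \<open>q-series\<close>

definition qpochhammer :: "'a \<Rightarrow> 'a \<Rightarrow> nat \<Rightarrow> 'a :: comm_ring_1" where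
  "qpochhammer a q L = (\<Prod>m<L. 1 - a * q ^ m)"

text \<open>
  The arguments m and n are integers, since the lower argument may be negative.
  For power series over a field, the division is exact when q has constant term 0,
  because the denominator then has constant term 1.
\<close>

definition qbinomial :: "'a \<Rightarrow> int \<Rightarrow> int \<Rightarrow> 'a :: {comm_ring_1, inverse}" where
  "qbinomial q m n =
     (if 0 \<le> n \<and> n \<le> m
      then qpochhammer q q (nat m) / (qpochhammer q q (nat n) * qpochhammer q q (nat (m - n)))
      else 0)"

text \<open>The index set is finite, as shown at the end of this theory.\<close>

definition GSC :: "nat \<Rightarrow> nat \<Rightarrow> int \<Rightarrow> 'a \<Rightarrow> 'a :: comm_ring_1" where
  "GSC M t k q =
     (\<Sum>p\<in>{p \<in> self_conjugate_partitions. gbg_rank t p = of_int k \<and> largest_part p \<le> M}.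
        q ^ sum_list p)"

section \<open>Well-definedness\<close>

lemma young_row:
  assumes "i < length p"
  shows "{j. (Suc i, j) \<in> young_diagram p} = {1..p ! i}"
  using assms by (auto simp: young_diagram_def)

lemma young_diagram_length:
  assumes "is_partition p"
  shows "{i. (Suc i, 1) \<in> young_diagram p} = {..<length p}"
proof -
  have "Suc 0 \<le> p ! i" if "i < length p" for i
    using assms nth_mem[OF that] by (simp add: is_partition_def Suc_le_eq)
  thus ?thesis by (auto simp: young_diagram_def)
qed

lemma young_diagram_inj:
  assumes "is_partition p" "is_partition p'" "young_diagram p = young_diagram p'"
  shows "p = p'"
proof (rule nth_equalityI)
  have "{..<length p} = {..<length p'}"
    using assms young_diagram_length by metis
  thus len: "length p = length p'" by simp
  fix i assume i: "i < length p"
  have "{1..p ! i} = {1..p' ! i}"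
    using young_row[OF i] young_row[of i p'] i len assms(3) by metis
  thus "p ! i = p' ! i"
    by (metis card_atLeastAtMost diff_Suc_1 Suc_eq_plus1)
qed

lemma part_le_largest_part: "x \<in> set p \<Longrightarrow> x \<le> largest_part p"
  by (simp add: largest_part_def)

lemma conjugate_exists:
  assumes p: "is_partition p"
  shows "\<exists>p'. is_partition p' \<and> young_diagram p' = prod.swap ` young_diagram p"
proof -
  define S where "S j = {i. i < length p \<and> j < p ! i}" for j
  define c where "c j = card (S j)" for j
  have fin: "finite (S j)" for j by (simp add: S_def)
  have down: "i' \<in> S j" if "i \<in> S j" "i' \<le> i" for i i' j
  proof (cases "i' = i")
    case False
    hence "p ! i \<le> p ! i'"
      using that p by (auto simp: is_partition_def S_def sorted_wrt_iff_nth_less)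
    thus ?thesis using that by (auto simp: S_def)
  qed (use that in simp)
  have S_eq: "S j = {..<c j}" for j
  proof -
    have "\<exists>n. S j = {..<n}"
    proof (intro exI set_eqI iffI)
      fix x
      define n where "n = (LEAST n. n \<notin> S j)"
      have nn: "n \<notin> S j"
        unfolding n_def by (rule LeastI_ex) (use fin[of j] infinite_UNIV_nat in \<open>metis UNIV_eq_I\<close>)
      show "x \<in> {..<LEAST n. n \<notin> S j}" if "x \<in> S j"
        using that nn down[of x j n] by (fold n_def) (meson lessThan_iff not_le)
      show "x \<in> S j" if "x \<in> {..<LEAST n. n \<notin> S j}"
        using that not_less_Least by blast
    qed
    then obtain n where "S j = {..<n}" ..
    thus ?thesis by (simp add: c_def)
  qed
  define p' where "p' = map c [0..<largest_part p]"
  have pos: "c j > 0" if "j < largest_part p" for j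
  proof -
    have "largest_part p \<in> insert 0 (set p)"
      unfolding largest_part_def by (rule Max_in) auto
    hence "largest_part p \<in> set p" using that by auto
    then obtain i where "i < length p" "p ! i = largest_part p"
      by (auto simp: in_set_conv_nth)
    hence "i \<in> S j" using that by (simp add: S_def)
    thus ?thesis using S_eq[of j] by auto
  qed
  have "c j' \<le> c j" if "j \<le> j'" for j j'
    unfolding c_def by (rule card_mono[OF fin]) (use that in \<open>auto simp: S_def\<close>)
  hence part: "is_partition p'"
    using pos by (auto simp: is_partition_def p'_def sorted_wrt_iff_nth_less)
  have mem: "i < c j \<longleftrightarrow> i < length p \<and> j < p ! i" for i j
    using S_eq[of j] by (auto simp: S_def)
  have "(a, b) \<in> young_diagram p' \<longleftrightarrow> (b, a) \<in> young_diagram p" for a b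
  proof (cases "a = 0 \<or> b = 0")
    case False
    then obtain j i where [simp]: "a = Suc j" "b = Suc i"
      by (metis not0_implies_Suc)
    have "j < largest_part p" if "i < length p" "j < p ! i"
      using that part_le_largest_part[of "p ! i" p] by simp
    moreover have "(a, b) \<in> young_diagram p' \<longleftrightarrow> j < largest_part p \<and> i < c j"
      by (auto simp: young_diagram_def p'_def)
    ultimately show ?thesis using mem[of i j]
      by (auto simp: young_diagram_def)
  qed (auto simp: young_diagram_def)
  hence "young_diagram p' = prod.swap ` young_diagram p"
    by (force simp: image_iff)
  with part show ?thesis by blast
qed

lemma conjugate:
  assumes "is_partition p"
  shows "is_partition (conjugate p)"
    and "young_diagram (conjugate p) = prod.swap ` young_diagram p"
proof -
  have "\<exists>!p'. is_partition p' \<and> young_diagram p' = prod.swap ` young_diagram p"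
    using conjugate_exists[OF assms] young_diagram_inj by (metis (no_types, lifting))
  from theI'[OF this]
  show "is_partition (conjugate p)"
    and "young_diagram (conjugate p) = prod.swap ` young_diagram p"
    by (simp_all add: conjugate_def)
qed

lemma finite_self_conjugate_bounded:
  "finite {p \<in> self_conjugate_partitions. largest_part p \<le> M}"
proof (rule finite_subset)
  show "finite {p. set p \<subseteq> {..M} \<and> length p \<le> M}"
    by (rule finite_lists_length_le) simp
  show "{p \<in> self_conjugate_partitions. largest_part p \<le> M}
          \<subseteq> {p. set p \<subseteq> {..M} \<and> length p \<le> M}"
  proof safe
    fix p assume p: "p \<in> self_conjugate_partitions" and M: "largest_part p \<le> M"
    have ip: "is_partition p" and sc: "conjugate p = p"
      using p by (simp_all add: self_conjugate_partitions_def)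
    have sym: "young_diagram p = prod.swap ` young_diagram p"
      using conjugate(2)[OF ip] unfolding sc .
    show "x \<le> M" if "x \<in> set p" for x
      using part_le_largest_part[OF that] M by simp
    show "length p \<le> M"
    proof (cases "length p")
      case (Suc l)
      have "(Suc l, 1) \<in> young_diagram p"
        using young_diagram_length[OF ip] Suc by auto
      hence "(1, Suc l) \<in> young_diagram p"
        using sym by (metis pair_in_swap_image)
      hence "Suc l \<le> p ! 0" by (simp add: young_diagram_def)
      moreover have "p ! 0 \<in> set p" using Suc by simp
      ultimately show ?thesis using part_le_largest_part[of "p ! 0" p] M Suc by simp
    qed simp
  qed
qed

lemma finite_GSC_index:
  "finite {p \<in> self_conjugate_partitions. gbg_rank t p = of_int k \<and> largest_part p \<le> M}"
  by (rule finite_subset[OF _ finite_self_conjugate_bounded[of M]]) auto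

text \<open>The exponent of the leading monomial in the product formula is nonnegative for every integer k.\<close>

lemma leading_exponent_nonneg:
  assumes "t \<ge> 1"
  shows "int t * k\<^sup>2 - (int t - 1) * k \<ge> 0"
proof -
  have eq: "int t * k\<^sup>2 - (int t - 1) * k = k * ((int t - 1) * (k - 1) + k)"
    by algebra
  show ?thesis
  proof (cases "k \<ge> 1")
    case True
    hence "(int t - 1) * (k - 1) \<ge> 0" using assms by simp
    thus ?thesis unfolding eq using True by simp
  next
    case False
    hence "(int t - 1) * (k - 1) \<le> 0" using assms by (simp add: mult_nonneg_nonpos)
    thus ?thesis unfolding eq using False by (simp add: mult_nonpos_nonpos)
  qed
qed

end

theory Submission
  imports Defs "HOL-Computational_Algebra.Polynomial"
begin

text \<open>
  Let w be a primitive t-th root of unity. Removing the first principal hook from a self-conjugate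
  partition with largest part M + 1 leaves an arbitrary self-conjugate partition with parts at most
  M; the hook has 2M + 1 cells and contributes
  \<open>h(M) = w\<^bsup>-M\<^esup> + \<dots> + w\<^bsup>M\<^esup>\<close> to the GBG-rank. Hence the generating function \<open>F\<^sub>M(z)\<close> of these
  partitions by rank z satisfies \<open>F\<^bsub>M+1\<^esub>(z) = F\<^sub>M(z) + q\<^bsup>2M+1\<^esup> F\<^sub>M(z - h(M))\<close>.
  The value h(M) depends only on M mod t, and h(t - 1 - r) = - h(r). So at
  \<open>z = \<Sum> c\<^sub>r h(r)\<close>, with r < (t - 1) / 2, each step of the recursion changes only one \<open>c\<^sub>r\<close>, and
  the two q-Pascal rules show that \<open>F\<^sub>M\<close> is a product of one q-binomial coefficient for every pair of
  residues {r, t - 1 - r}; the middle residue has h = 0 and gives the q-Pochhammer factor. The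
  induction starts because the h(r) are linearly independent over the rationals, which is
  Eisenstein's criterion for the t-th cyclotomic polynomial.
\<close>

section \<open>Integer relations between powers of a root of unity\<close>

text \<open>As \<open>p\<^sup>2\<close> does not divide the constant coefficient of E, one factor,
  say Q, has constant coefficient prime to p. The first coefficient of P not divisible by p then
  yields such a coefficient of E at the same index, which must be \<open>degree E\<close>; so P
  takes up the whole degree.\<close>

lemma eisenstein_criterion:
  fixes E :: "int poly" and p :: int
  assumes p: "prime p"
    and coeffs: "\<And>i. i < degree E \<Longrightarrow> p dvd coeff E i"
    and lead: "\<not> p dvd lead_coeff E"
    and const: "\<not> p\<^sup>2 dvd coeff E 0"
    and E: "E = P * Q"
  shows "degree P = 0 \<or> degree Q = 0"
proof -
  have key: "degree Q = 0" if E: "E = P * Q" and Q0: "\<not> p dvd coeff Q 0" for P Q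
  proof -
    define j where "j = (LEAST j. \<not> p dvd coeff P j)"
    have "\<not> p dvd lead_coeff P"
      using lead E by (auto simp: lead_coeff_mult)
    hence j: "\<not> p dvd coeff P j" "j \<le> degree P"
      using LeastI[of "\<lambda>j. \<not> p dvd coeff P j" "degree P"]
        Least_le[of "\<lambda>j. \<not> p dvd coeff P j" "degree P"]
      by (simp_all add: j_def)
    have "p dvd (\<Sum>i<j. coeff P i * coeff Q (j - i))"
      by (intro dvd_sum dvd_mult2) (use not_less_Least j_def in blast)
    moreover have "coeff E j = (\<Sum>i<j. coeff P i * coeff Q (j - i)) + coeff P j * coeff Q 0"
      unfolding E coeff_mult by (simp flip: lessThan_Suc_atMost)
    moreover have "\<not> p dvd coeff P j * coeff Q 0"
      using p j(1) Q0 by (simp add: prime_dvd_mult_iff)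
    ultimately have "\<not> p dvd coeff E j"
      by (simp add: dvd_add_right_iff)
    hence "degree E \<le> j" using coeffs[of j] by force
    moreover have "degree E = degree P + degree Q"
      using lead unfolding E by (intro degree_mult_eq) auto
    ultimately show ?thesis using j by simp
  qed
  \<comment> \<open>At least one factor satisfies the hypothesis of \<open>key\<close>; the other
    case is symmetric.\<close>
  have "\<not> (p dvd coeff P 0 \<and> p dvd coeff Q 0)"
    using const unfolding E by (auto simp: coeff_mult power2_eq_square intro: mult_dvd_mono)
  thus ?thesis using key[of P Q] key[of Q P] E by (auto simp: mult.commute)
qed

text \<open>Polynomials stay over the integers, where content and primitive part make sense,
  although the roots of interest are complex.\<close>

definition int_poly_eval :: "int poly \<Rightarrow> complex \<Rightarrow> complex" where
  "int_poly_eval P x = poly (map_poly of_int P) x"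

lemma int_poly_eval_pCons [simp]:
  "int_poly_eval (pCons a P) x = of_int a + x * int_poly_eval P x"
  by (simp add: int_poly_eval_def map_poly_pCons)

lemma int_poly_eval_0 [simp]: "int_poly_eval 0 x = 0"
  by (simp add: int_poly_eval_def)

lemma int_poly_eval_add [simp]:
  "int_poly_eval (P + Q) x = int_poly_eval P x + int_poly_eval Q x"
  by (induction P Q rule: poly_induct2) (simp_all add: algebra_simps)

lemma int_poly_eval_smult [simp]: "int_poly_eval (smult c P) x = of_int c * int_poly_eval P x"
  by (induction P) (simp_all add: algebra_simps)

lemma int_poly_eval_diff [simp]:
  "int_poly_eval (P - Q) x = int_poly_eval P x - int_poly_eval Q x"
  using int_poly_eval_add[of "P - Q" Q x] by (simp del: int_poly_eval_add)

lemma int_poly_eval_mult [simp]: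
  "int_poly_eval (P * Q) x = int_poly_eval P x * int_poly_eval Q x"
  by (induction P) (simp_all add: algebra_simps)

lemma int_poly_eval_pcompose [simp]:
  "int_poly_eval (pcompose P Q) x = int_poly_eval P (int_poly_eval Q x)"
  by (induction P) (simp_all add: pcompose_pCons)

lemma int_poly_eval_monom [simp]: "int_poly_eval (monom c n) x = of_int c * x ^ n"
  by (simp add: int_poly_eval_def map_poly_monom poly_monom)

lemma int_poly_eval_sum [simp]:
  "int_poly_eval (sum f A) x = (\<Sum>i\<in>A. int_poly_eval (f i) x)"
  by (induction A rule: infinite_finite_induct) auto

text \<open>
  Let P be a nonzero integer polynomial of least degree vanishing at x. Pseudo-division shows that
  P divides a constant multiple of E, and Gauss's lemma lets us cancel that constant.
\<close>

lemma degree_le_degree_if_root_of_irreducible: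
  fixes E P :: "int poly"
  assumes irred: "\<And>P Q. E = P * Q \<Longrightarrow> degree P = 0 \<or> degree Q = 0"
    and content: "content E = 1"
    and E: "int_poly_eval E x = 0"
    and P: "int_poly_eval P x = 0" "P \<noteq> 0"
  shows "degree E \<le> degree P"
proof -
  define good where "good R \<longleftrightarrow> R \<noteq> 0 \<and> int_poly_eval R x = 0" for R
  obtain R where R: "good R" and min: "\<And>S. good S \<Longrightarrow> degree R \<le> degree S"
    using ex_has_least_nat[of good P degree] P by (auto simp: good_def)
  \<comment> \<open>Content 1 is what later makes the content of the cofactor T equal to
    \<open>a\<close> up to sign.\<close>
  define S where "S = primitive_part R"
  have "int_poly_eval R x = of_int (content R) * int_poly_eval S x"
    unfolding S_def by (metis content_times_primitive_part int_poly_eval_smult)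
  hence S: "S \<noteq> 0" "int_poly_eval S x = 0" "degree S = degree R" "content S = 1"
    using R by (auto simp: S_def good_def)
  have "degree S \<noteq> 0"
  proof
    assume "degree S = 0"
    then obtain c where "S = [:c:]" by (meson degree_eq_zeroE)
    with S show False by simp
  qed
  obtain a T where aT: "a \<noteq> 0" "smult a E = S * T + pseudo_mod E S"
    using pseudo_mod(1)[OF S(1), of E] by blast
  \<comment> \<open>The remainder also vanishes at x, so minimality of the degree forces it to be
    0.\<close>
  have "int_poly_eval (pseudo_mod E S) x = 0"
    using arg_cong[OF aT(2), of "\<lambda>P. int_poly_eval P x"] E S by simp
  moreover have "pseudo_mod E S = 0 \<or> degree (pseudo_mod E S) < degree S"
    by (rule pseudo_mod(2)[OF S(1)])
  ultimately have "pseudo_mod E S = 0"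
    using min[of "pseudo_mod E S"] S(3) by (metis good_def leD)
  hence eq: "smult a E = S * T" using aT by simp
  have "normalize a = content T"
    using arg_cong[OF eq, of content] content S by (simp add: content_mult)
  hence "a dvd content T" by (metis dvd_normalize_iff dvd_refl)
  hence "[:a:] dvd T" by (simp add: const_poly_dvd_iff_dvd_content)
  then obtain T' where "T = smult a T'" by (auto elim: dvdE)
  hence "smult a (E - S * T') = 0" using eq by (simp add: mult_smult_right smult_diff_right)
  hence "E = S * T'" using aT(1) by simp
  moreover from this have "E \<noteq> 0 \<Longrightarrow> degree E = degree S + degree T'"
    by (auto intro: degree_mult_eq)
  ultimately have "degree E \<le> degree S"
    using irred[of S T'] \<open>degree S \<noteq> 0\<close> by (cases "E = 0") auto
  also have "\<dots> \<le> degree P" using min[of P] P S by (simp add: good_def)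
  finally show ?thesis .
qed

text \<open>The p-th cyclotomic polynomial shifted by 1 satisfies Eisenstein's criterion and
  vanishes at x - 1, so no nonzero integer polynomial of degree below p - 1 vanishes at x.\<close>

lemma int_poly_eval_root_of_unity_eq_0:
  fixes x :: complex and p :: nat
  assumes p: "prime p" and x: "x ^ p = 1" "x \<noteq> 1"
    and P: "int_poly_eval P x = 0" "degree P < p - 1"
  shows "P = 0"
proof (rule ccontr)
  assume "P \<noteq> 0"
  \<comment> \<open>This is \<open>((1 + X) ^ p - 1) / X\<close>: the inner binomial coefficients
    are divisible by p, the constant one is p and the leading one is 1.\<close>
  define E :: "int poly" where "E = (\<Sum>i<p. monom (int (p choose Suc i)) i)"
  have coeff: "coeff E i = (if i < p then int (p choose Suc i) else 0)" for i
    unfolding E_def coeff_sum by (simp add: coeff_monom)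
  have p2: "p \<ge> 2" using p by (rule prime_ge_2_nat)
  have deg: "degree E = p - 1"
  proof (rule antisym)
    show "degree E \<le> p - 1" by (rule degree_le) (use p2 in \<open>auto simp: coeff\<close>)
    show "p - 1 \<le> degree E" by (rule le_degree) (use p2 in \<open>auto simp: coeff\<close>)
  qed
  have lead: "lead_coeff E = 1" using p2 by (simp add: coeff deg)
  have irred: "degree R = 0 \<or> degree S = 0" if "E = R * S" for R S
  proof (rule eisenstein_criterion[of "int p", OF _ _ _ _ that])
    show "int p dvd coeff E i" if "i < degree E" for i
      using that deg p by (auto simp: coeff intro!: dvd_choose_prime)
    show "\<not> (int p)\<^sup>2 dvd coeff E 0"
      using p2 by (auto simp: coeff power2_eq_square dest: zdvd_imp_le)
  qed (use p lead p2 in auto)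
  have "content E = 1"
    using content_dvd_coeff[of E "degree E"] lead
    by (simp add: is_unit_content_iff[symmetric] del: is_unit_content_iff)
  define y where "y = x - 1"
  have "(1 + y) ^ p = (\<Sum>i\<le>p. of_nat (p choose i) * y ^ i)"
    by (subst add.commute) (simp add: binomial_ring)
  also have "\<dots> = 1 + (\<Sum>i<p. of_nat (p choose Suc i) * y ^ Suc i)"
    using sum.atMost_Suc_shift[of "\<lambda>i. of_nat (p choose i) * y ^ i" "p - 1"] p2
    by (simp add: lessThan_Suc_atMost[symmetric])
  also have "\<dots> = 1 + y * int_poly_eval E y"
    by (simp add: E_def sum_distrib_left mult_ac)
  finally have "int_poly_eval E y = 0" using x by (simp add: y_def)
  \<comment> \<open>Substituting 1 + X moves the root from x to y = x - 1 and keeps the degree of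
    P.\<close>
  moreover have "int_poly_eval (pcompose P [:1, 1:]) y = 0"
    using P by (simp add: y_def)
  moreover have "pcompose P [:1, 1:] \<noteq> 0"
    using \<open>P \<noteq> 0\<close> by (simp add: pcompose_eq_0_iff)
  ultimately have "degree E \<le> degree (pcompose P [:1, 1:])"
    using degree_le_degree_if_root_of_irreducible[OF irred \<open>content E = 1\<close>] by blast
  thus False using P(2) deg by (simp add: degree_pcompose)
qed

section \<open>Self-conjugate diagrams\<close>

text \<open>These are the Young diagrams of self-conjugate partitions with parts at most M. As sets
  of cells, they make adding a hook a disjoint union.\<close>

definition symmetric_diagrams :: "nat \<Rightarrow> (nat \<times> nat) set set" where
  "symmetric_diagrams M = {D. D \<subseteq> {1..M} \<times> {1..M} \<and>
     (\<forall>i j. (i, j) \<in> D \<longrightarrow> (j, i) \<in> D) \<and>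
     (\<forall>i j i' j'. (i, j) \<in> D \<longrightarrow> 1 \<le> i' \<longrightarrow> i' \<le> i \<longrightarrow> 1 \<le> j' \<longrightarrow> j' \<le> j \<longrightarrow> (i', j') \<in> D)}"

lemma symmetric_diagrams_bound: "D \<in> symmetric_diagrams M \<Longrightarrow> D \<subseteq> {1..M} \<times> {1..M}"
  by (simp add: symmetric_diagrams_def)

lemma symmetric_diagrams_swap: "D \<in> symmetric_diagrams M \<Longrightarrow> (i, j) \<in> D \<Longrightarrow> (j, i) \<in> D"
  unfolding symmetric_diagrams_def by blast

lemma symmetric_diagrams_down:
  "D \<in> symmetric_diagrams M \<Longrightarrow> (i, j) \<in> D \<Longrightarrow> 1 \<le> i' \<Longrightarrow> i' \<le> i \<Longrightarrow> 1 \<le> j' \<Longrightarrow> j' \<le> j \<Longrightarrow> (i', j') \<in> D"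
  unfolding symmetric_diagrams_def by blast

lemma finite_symmetric_diagram: "D \<in> symmetric_diagrams M \<Longrightarrow> finite D"
  by (rule finite_subset[OF symmetric_diagrams_bound]) auto

lemma finite_symmetric_diagrams: "finite (symmetric_diagrams M)"
  by (rule finite_subset[of _ "Pow ({1..M} \<times> {1..M})"]) (auto simp: symmetric_diagrams_def)

lemma self_conjugate_iff:
  assumes "is_partition p"
  shows "conjugate p = p \<longleftrightarrow> (\<forall>i j. (i, j) \<in> young_diagram p \<longrightarrow> (j, i) \<in> young_diagram p)"
proof
  assume "conjugate p = p"
  hence "young_diagram p = prod.swap ` young_diagram p"
    using conjugate(2)[OF assms] by simp
  thus "\<forall>i j. (i, j) \<in> young_diagram p \<longrightarrow> (j, i) \<in> young_diagram p"
    by (metis pair_in_swap_image)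
next
  assume sym: "\<forall>i j. (i, j) \<in> young_diagram p \<longrightarrow> (j, i) \<in> young_diagram p"
  have "prod.swap ` young_diagram p = young_diagram p"
    using sym by (force simp: image_iff)
  thus "conjugate p = p"
    using conjugate[OF assms] young_diagram_inj[OF _ assms] by simp
qed

lemma young_diagram_down:
  assumes "is_partition p" "(i, j) \<in> young_diagram p" "1 \<le> i'" "i' \<le> i" "1 \<le> j'" "j' \<le> j"
  shows "(i', j') \<in> young_diagram p"
proof -
  have "p ! (i - 1) \<le> p ! (i' - 1)"
  proof (cases "i' = i")
    case False
    hence "i' - 1 < i - 1" "i - 1 < length p"
      using assms by (auto simp: young_diagram_def)
    thus ?thesis
      using assms(1) unfolding is_partition_def sorted_wrt_iff_nth_less by blast
  qed simp
  thus ?thesis using assms by (auto simp: young_diagram_def)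
qed

lemma young_diagram_in_symmetric_diagrams:
  assumes p: "p \<in> self_conjugate_partitions" and M: "largest_part p \<le> M"
  shows "young_diagram p \<in> symmetric_diagrams M"
proof -
  have ip: "is_partition p" and sym: "\<And>i j. (i, j) \<in> young_diagram p \<Longrightarrow> (j, i) \<in> young_diagram p"
    using p self_conjugate_iff by (auto simp: self_conjugate_partitions_def)
  have "j \<in> {1..M}" if "(i, j) \<in> young_diagram p" for i j
  proof -
    have "p ! (i - 1) \<in> set p" using that by (auto simp: young_diagram_def)
    hence "p ! (i - 1) \<le> M" using part_le_largest_part M le_trans by blast
    thus ?thesis using that by (auto simp: young_diagram_def)
  qed
  hence "young_diagram p \<subseteq> {1..M} \<times> {1..M}" using sym by fast
  thus ?thesis
    using sym young_diagram_down[OF ip] unfolding symmetric_diagrams_def by blast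
qed

lemma symmetric_diagram_is_young_diagram:
  assumes D: "D \<in> symmetric_diagrams M"
  obtains p where "p \<in> self_conjugate_partitions" "largest_part p \<le> M" "young_diagram p = D"
proof -
  have fin: "finite {j. (i, j) \<in> D}" for i
    by (rule finite_subset[of _ "{1..M}"]) (use symmetric_diagrams_bound[OF D] in auto)
  define r where "r i = card {j. (Suc i, j) \<in> D}" for i
  have row: "{j. (Suc i, j) \<in> D} = {1..r i}" for i
  proof (cases "{j. (Suc i, j) \<in> D} = {}")
    case True
    thus ?thesis by (simp add: r_def)
  next
    case False
    define m where "m = Max {j. (Suc i, j) \<in> D}"
    have "(Suc i, m) \<in> D" using Max_in[OF fin False] by (simp add: m_def)
    hence "(Suc i, j) \<in> D" if "1 \<le> j" "j \<le> m" for j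
      using that symmetric_diagrams_down[OF D, of "Suc i" m "Suc i" j] by simp
    moreover have "1 \<le> j \<and> j \<le> m" if "(Suc i, j) \<in> D" for j
    proof
      show "1 \<le> j" using that symmetric_diagrams_bound[OF D] by auto
      show "j \<le> m" unfolding m_def by (rule Max_ge[OF fin]) (use that in simp)
    qed
    ultimately have "{j. (Suc i, j) \<in> D} = {1..m}"
      unfolding set_eq_iff atLeastAtMost_iff mem_Collect_eq by blast
    thus ?thesis by (simp add: r_def)
  qed
  have mem: "(Suc i, j) \<in> D \<longleftrightarrow> 1 \<le> j \<and> j \<le> r i" for i j
    using row[of i] by (auto simp: set_eq_iff)
  \<comment> \<open>By symmetry the first column is as long as the first row, so there are
    \<open>r 0\<close> nonempty rows.\<close>
  define p where "p = map r [0..<r 0]"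
  have len: "i < r 0 \<longleftrightarrow> r i > 0" for i
  proof -
    have "i < r 0 \<longleftrightarrow> (1, Suc i) \<in> D" using mem[of 0 "Suc i"] by auto
    also have "\<dots> \<longleftrightarrow> (Suc i, 1) \<in> D" by (metis symmetric_diagrams_swap[OF D])
    also have "\<dots> \<longleftrightarrow> r i > 0" using mem[of i 1] by auto
    finally show ?thesis .
  qed
  have anti: "r j \<le> r i" if "i \<le> j" for i j
  proof (cases "r j")
    case (Suc n)
    hence "(Suc j, r j) \<in> D" using mem[of j "r j"] by simp
    hence "(Suc i, r j) \<in> D"
      using that Suc symmetric_diagrams_down[OF D, of "Suc j" "r j" "Suc i" "r j"] by simp
    thus ?thesis using mem by blast
  qed simp
  have ip: "is_partition p"
    unfolding is_partition_def
  proof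
    show "sorted_wrt (\<ge>) p"
      using anti by (simp add: p_def sorted_wrt_iff_nth_less)
    show "\<forall>x\<in>set p. 0 < x" using len by (auto simp: p_def)
  qed
  have "(i, j) \<in> young_diagram p \<longleftrightarrow> (i, j) \<in> D" for i j
  proof (cases i)
    case 0
    thus ?thesis using symmetric_diagrams_bound[OF D] by (auto simp: young_diagram_def)
  next
    case (Suc i')
    thus ?thesis using len[of i'] by (auto simp: young_diagram_def p_def mem)
  qed
  hence yd: "young_diagram p = D" by auto
  have "p \<in> self_conjugate_partitions"
    using ip self_conjugate_iff[OF ip] symmetric_diagrams_swap[OF D]
    unfolding yd self_conjugate_partitions_def by blast
  moreover have "x \<le> M" if x: "x \<in> set p" for x
  proof -
    obtain i where i: "i < r 0" "x = r i" using x unfolding p_def by auto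
    hence "(Suc i, x) \<in> D" unfolding mem i(2) using len[of i] by (simp add: Suc_le_eq)
    from subsetD[OF symmetric_diagrams_bound[OF D] this] show ?thesis by simp
  qed
  hence "largest_part p \<le> M" by (simp add: largest_part_def)
  ultimately show ?thesis using yd by (rule that)
qed

lemma bij_betw_young_diagram:
  "bij_betw young_diagram {p \<in> self_conjugate_partitions. largest_part p \<le> M} (symmetric_diagrams M)"
  unfolding bij_betw_def
proof
  show "inj_on young_diagram {p \<in> self_conjugate_partitions. largest_part p \<le> M}"
    by (auto intro!: inj_onI young_diagram_inj simp: self_conjugate_partitions_def)
  show "young_diagram ` {p \<in> self_conjugate_partitions. largest_part p \<le> M} = symmetric_diagrams M"
    using young_diagram_in_symmetric_diagrams
    by (auto elim!: symmetric_diagram_is_young_diagram[of _ M])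
qed

section \<open>Size and rank of a partition as sums over cells\<close>

lemma young_diagram_eq_Sigma: "young_diagram p = Sigma {1..length p} (\<lambda>i. {1..p ! (i - 1)})"
  by (auto simp: young_diagram_def)

lemma finite_young_diagram: "finite (young_diagram p)"
  by (simp add: young_diagram_eq_Sigma)

lemma card_young_diagram: "card (young_diagram p) = sum_list p"
proof -
  have "card (young_diagram p) = (\<Sum>i=1..length p. p ! (i - 1))"
    by (simp add: young_diagram_eq_Sigma)
  also have "\<dots> = (\<Sum>i<length p. p ! i)"
    by (rule sum.reindex_bij_witness[of _ Suc "\<lambda>i. i - 1"]) auto
  finally show ?thesis by (simp add: sum_list_sum_nth atLeast0LessThan)
qed

text \<open>Integer exponents replace the labels reduced modulo t; for a t-th root of unity the
  value is the same, and diagonal shifts leave it unchanged.\<close>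

definition diagram_rank :: "complex \<Rightarrow> (nat \<times> nat) set \<Rightarrow> complex" where
  "diagram_rank w D = (\<Sum>(i, j)\<in>D. w powi (int j - int i))"

lemma power_int_mod_period:
  fixes w :: complex
  assumes "w ^ t = 1" "t > 0"
  shows "w ^ nat (a mod int t) = w powi a"
proof -
  have w0: "w \<noteq> 0" using assms by (auto simp: power_0_left)
  have "w powi a = w powi (int t * (a div int t) + a mod int t)" by simp
  also have "\<dots> = w powi (a mod int t)"
    using assms by (subst power_int_add[OF disjI1[OF w0]], subst power_int_mult) simp
  also have "\<dots> = w ^ nat (a mod int t)"
    using assms by (simp add: power_int_def)
  finally show ?thesis ..
qed

lemma gbg_rank_eq_diagram_rank:
  assumes t: "t > 0" and w: "w = exp (2 * of_real pi * \<i> / of_nat t)"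
  shows "gbg_rank t p = diagram_rank w (young_diagram p)"
proof -
  have wt: "w ^ t = 1"
    using t by (simp add: w flip: exp_of_nat_mult)
  have lab: "cell_label t c < t" for c
    using t by (simp add: cell_label_def nat_less_iff)
  have "gbg_rank t p = (\<Sum>s<t. \<Sum>c | c \<in> young_diagram p \<and> cell_label t c = s. w ^ cell_label t c)"
    unfolding gbg_rank_def label_count_def w
    by (rule sum.cong) (use t in \<open>auto simp: atLeast0AtMost\<close>)
  also have "\<dots> = (\<Sum>c\<in>young_diagram p. w ^ cell_label t c)"
    by (rule sum.group) (use lab in \<open>auto simp: finite_young_diagram\<close>)
  also have "\<dots> = diagram_rank w (young_diagram p)"
    unfolding diagram_rank_def
    by (rule sum.cong) (auto simp: cell_label_def power_int_mod_period[OF wt t])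
  finally show ?thesis .
qed

text \<open>The rank z ranges over all complex numbers, because subtracting hook ranks leaves the
  integers.\<close>

definition rank_gf :: "complex \<Rightarrow> nat \<Rightarrow> complex \<Rightarrow> 'a \<Rightarrow> 'a :: comm_ring_1" where
  "rank_gf w M z q = (\<Sum>D\<in>{D \<in> symmetric_diagrams M. diagram_rank w D = z}. q ^ card D)"

lemma GSC_eq_rank_gf:
  assumes t: "t > 0" and w: "w = exp (2 * of_real pi * \<i> / of_nat t)"
  shows "GSC M t k q = rank_gf w M (of_int k) q"
proof -
  let ?A = "{p \<in> self_conjugate_partitions. largest_part p \<le> M}"
  have "GSC M t k q = (\<Sum>p\<in>{p \<in> ?A. diagram_rank w (young_diagram p) = of_int k}.
      q ^ card (young_diagram p))"
    unfolding GSC_def card_young_diagram gbg_rank_eq_diagram_rank[OF assms]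
    by (rule sum.cong) auto
  also have "\<dots> = rank_gf w M (of_int k) q"
    unfolding rank_gf_def
  proof (rule sum.reindex_bij_betw)
    show "bij_betw young_diagram {p \<in> ?A. diagram_rank w (young_diagram p) = of_int k}
        {D \<in> symmetric_diagrams M. diagram_rank w D = of_int k}"
      unfolding bij_betw_def
    proof
      show "inj_on young_diagram {p \<in> ?A. diagram_rank w (young_diagram p) = of_int k}"
        by (rule inj_on_subset[OF bij_betw_imp_inj_on[OF bij_betw_young_diagram]]) auto
      show "young_diagram ` {p \<in> ?A. diagram_rank w (young_diagram p) = of_int k} =
          {D \<in> symmetric_diagrams M. diagram_rank w D = of_int k}"
        unfolding bij_betw_imp_surj_on[OF bij_betw_young_diagram, symmetric] by blast
    qed
  qed
  finally show ?thesis .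
qed

section \<open>Removing the first principal hook\<close>

definition principal_hook :: "nat \<Rightarrow> (nat \<times> nat) set" where
  "principal_hook M = {1} \<times> {1..Suc M} \<union> {1..Suc M} \<times> {1}"

text \<open>The shift along the diagonal preserves \<open>j - i\<close>, hence the rank, and frees
  the first row and column for the hook.\<close>

definition add_hook :: "nat \<Rightarrow> (nat \<times> nat) set \<Rightarrow> (nat \<times> nat) set" where
  "add_hook M D = principal_hook M \<union> map_prod Suc Suc ` D"

text \<open>Natural subtraction sends both 0 and 1 to 0, but D has no cell with a coordinate 0; so
  the last disjunct holds only for i and j at least 2.\<close>

lemma mem_add_hook:
  assumes "D \<in> symmetric_diagrams M"
  shows "(i, j) \<in> add_hook M D \<longleftrightarrow>
    i = 1 \<and> 1 \<le> j \<and> j \<le> Suc M \<or> j = 1 \<and> 1 \<le> i \<and> i \<le> Suc M \<or> (i - 1, j - 1) \<in> D"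
proof -
  have "(i - 1, j - 1) \<in> D \<longleftrightarrow> (i, j) \<in> map_prod Suc Suc ` D"
  proof
    assume *: "(i - 1, j - 1) \<in> D"
    have "1 \<le> i - 1" "1 \<le> j - 1"
      using subsetD[OF symmetric_diagrams_bound[OF assms] *]
      unfolding mem_Sigma_iff atLeastAtMost_iff by blast+
    hence "(i, j) = map_prod Suc Suc (i - 1, j - 1)" by simp
    thus "(i, j) \<in> map_prod Suc Suc ` D" using * by (rule image_eqI)
  qed auto
  thus ?thesis
    unfolding add_hook_def principal_hook_def Un_iff mem_Sigma_iff atLeastAtMost_iff singleton_iff
    by blast
qed

lemma inj_on_add_hook: "inj_on (add_hook M) (symmetric_diagrams M)"
proof (rule inj_onI)
  fix D D' assume D: "D \<in> symmetric_diagrams M" "D' \<in> symmetric_diagrams M"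
    and eq: "add_hook M D = add_hook M D'"
  have hook: "principal_hook M \<inter> map_prod Suc Suc ` E = {}" if "E \<in> symmetric_diagrams M" for E
    using symmetric_diagrams_bound[OF that] by (auto simp: principal_hook_def)
  have "map_prod Suc Suc ` E = add_hook M E - principal_hook M" if "E \<in> symmetric_diagrams M" for E
    using hook[OF that] unfolding add_hook_def by blast
  hence "map_prod Suc Suc ` D = map_prod Suc Suc ` D'" using D eq by simp
  moreover have "inj (map_prod Suc Suc)" by (intro prod.inj_map) auto
  ultimately show "D = D'" by (simp add: inj_image_eq_iff)
qed

text \<open>The cell \<open>(1, Suc M)\<close> decides. Without it, downward closure and symmetry
  keep the diagram inside the smaller square; with it, the first row and column are full, and the
  rest is a shifted diagram.\<close>

lemma symmetric_diagrams_Suc: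
  "symmetric_diagrams (Suc M) = symmetric_diagrams M \<union> add_hook M ` symmetric_diagrams M"
proof (intro equalityI subsetI)
  fix D assume "D \<in> symmetric_diagrams M \<union> add_hook M ` symmetric_diagrams M"
  thus "D \<in> symmetric_diagrams (Suc M)"
  proof
    assume "D \<in> symmetric_diagrams M"
    moreover have "{1..M} \<times> {1..M} \<subseteq> {1..Suc M} \<times> {1..Suc M}" by auto
    ultimately show ?thesis unfolding symmetric_diagrams_def by blast
  next
    assume "D \<in> add_hook M ` symmetric_diagrams M"
    then obtain E where E: "E \<in> symmetric_diagrams M" and D: "D = add_hook M E" by blast
    note b = symmetric_diagrams_bound[OF E] and s = symmetric_diagrams_swap[OF E]
      and d = symmetric_diagrams_down[OF E]
    note mem = mem_add_hook[OF E, folded D]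
    have D': "i \<in> {1..Suc M} \<and> j \<in> {1..Suc M}" if "(i, j) \<in> D" for i j
      using that subsetD[OF b, of "(i - 1, j - 1)"] unfolding mem by auto
    hence "D \<subseteq> {1..Suc M} \<times> {1..Suc M}" by auto
    moreover have "(j, i) \<in> D" if "(i, j) \<in> D" for i j
      using that s unfolding mem by blast
    moreover have "(i', j') \<in> D" if "(i, j) \<in> D" "1 \<le> i'" "i' \<le> i" "1 \<le> j'" "j' \<le> j" for i j i' j'
    proof (cases "i' = 1 \<or> j' = 1")
      case True
      have "i \<le> Suc M" "j \<le> Suc M" using D'[OF that(1)] by auto
      thus ?thesis using True that unfolding mem by auto
    next
      case False
      hence "(i - 1, j - 1) \<in> E" using that unfolding mem by auto
      hence "(i' - 1, j' - 1) \<in> E" by (rule d) (use False that in auto)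
      thus ?thesis unfolding mem by simp
    qed
    ultimately show ?thesis unfolding symmetric_diagrams_def by blast
  qed
next
  fix D assume D: "D \<in> symmetric_diagrams (Suc M)"
  note b = symmetric_diagrams_bound[OF D] and s = symmetric_diagrams_swap[OF D]
    and d = symmetric_diagrams_down[OF D]
  show "D \<in> symmetric_diagrams M \<union> add_hook M ` symmetric_diagrams M"
  proof (cases "(1, Suc M) \<in> D")
    case False
    have "j \<noteq> Suc M" if "(i, j) \<in> D" for i j
      using d[OF that, of 1 "Suc M"] subsetD[OF b that] False by auto
    hence "i \<noteq> Suc M \<and> j \<noteq> Suc M" if "(i, j) \<in> D" for i j
      using s that by blast
    hence "D \<subseteq> {1..M} \<times> {1..M}" using b by (auto simp: le_Suc_eq)
    hence "D \<in> symmetric_diagrams M"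
      using s d unfolding symmetric_diagrams_def by blast
    thus ?thesis ..
  next
    case True
    define E where "E = {(i, j). 1 \<le> i \<and> 1 \<le> j \<and> (Suc i, Suc j) \<in> D}"
    have E: "E \<in> symmetric_diagrams M"
    proof -
      have "E \<subseteq> {1..M} \<times> {1..M}" using b by (auto simp: E_def)
      moreover have "(j, i) \<in> E" if "(i, j) \<in> E" for i j
        using that s by (auto simp: E_def)
      moreover have "(i', j') \<in> E"
        if "(i, j) \<in> E" "1 \<le> i'" "i' \<le> i" "1 \<le> j'" "j' \<le> j" for i j i' j'
        using that d[of "Suc i" "Suc j" "Suc i'" "Suc j'"] by (auto simp: E_def)
      ultimately show ?thesis unfolding symmetric_diagrams_def by blast
    qed
    have "(i, j) \<in> D \<longleftrightarrow> (i, j) \<in> add_hook M E" for i j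
    proof -
      have row: "(1, j) \<in> D" if "1 \<le> j" "j \<le> Suc M" for j
        using d[OF True, of 1 j] that by simp
      have "(i, j) \<in> D \<Longrightarrow> 1 \<le> i \<and> i \<le> Suc M \<and> 1 \<le> j \<and> j \<le> Suc M" using b by auto
      thus ?thesis
        unfolding mem_add_hook[OF E] using row s[OF row] by (auto simp: E_def)
    qed
    hence "D = add_hook M E" by auto
    thus ?thesis using E by blast
  qed
qed

lemma symmetric_diagrams_disjoint: "symmetric_diagrams M \<inter> add_hook M ` symmetric_diagrams M = {}"
proof -
  have "(1, Suc M) \<in> add_hook M D" for D by (simp add: add_hook_def principal_hook_def)
  thus ?thesis using symmetric_diagrams_bound by fastforce
qed

section \<open>Size and rank of a principal hook\<close>

lemma principal_hook_Suc:
  "principal_hook (Suc M) = insert (1, Suc (Suc M)) (insert (Suc (Suc M), 1) (principal_hook M))"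
  by (auto simp: principal_hook_def le_Suc_eq)

lemma principal_hook_0: "principal_hook 0 = {(1, 1)}"
  by (auto simp: principal_hook_def)

lemma finite_principal_hook: "finite (principal_hook M)"
  by (simp add: principal_hook_def)

lemma card_principal_hook: "card (principal_hook M) = 2 * M + 1"
proof (induction M)
  case (Suc M)
  have "(1, Suc (Suc M)) \<notin> principal_hook M" "(Suc (Suc M), 1) \<notin> principal_hook M"
    by (auto simp: principal_hook_def)
  thus ?case using Suc by (simp add: principal_hook_Suc finite_principal_hook)
qed (simp add: principal_hook_0)

text \<open>This is the geometric sum of \<open>w powi c\<close> over \<open>- a \<le> c \<le> a\<close>, in closed form.\<close>

definition hook_rank :: "complex \<Rightarrow> int \<Rightarrow> complex" where
  "hook_rank w a = (w powi (a + 1) - w powi (- a)) / (w - 1)"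

lemma diagram_rank_principal_hook:
  assumes w: "w \<noteq> 0" "w \<noteq> 1"
  shows "diagram_rank w (principal_hook M) = hook_rank w (int M)"
proof (induction M)
  case 0
  show ?case using w by (simp add: principal_hook_0 diagram_rank_def hook_rank_def)
next
  case (Suc M)
  have "(1, Suc (Suc M)) \<notin> principal_hook M" "(Suc (Suc M), 1) \<notin> principal_hook M"
    by (auto simp: principal_hook_def)
  hence "diagram_rank w (principal_hook (Suc M)) =
      w powi (int M + 1) + w powi (- (int M + 1)) + diagram_rank w (principal_hook M)"
    by (simp add: principal_hook_Suc diagram_rank_def finite_principal_hook algebra_simps)
  also have "\<dots> = hook_rank w (int (Suc M))"
  proof -
    have "w powi (int M + 2) = w * w powi (int M + 1)"
      using w power_int_add[of w 1 "int M + 1"] by (simp add: add_ac)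
    moreover have "w powi (- int M) = w * w powi (- (int M + 1))"
      using w power_int_add[of w 1 "- (int M + 1)"] by simp
    ultimately show ?thesis
      using w unfolding Suc hook_rank_def by (simp add: field_simps)
  qed
  finally show ?case .
qed

lemma add_hook_stats:
  assumes D: "D \<in> symmetric_diagrams M" and w: "w \<noteq> 0" "w \<noteq> 1"
  shows "card (add_hook M D) = 2 * M + 1 + card D"
    and "diagram_rank w (add_hook M D) = hook_rank w (int M) + diagram_rank w D"
proof -
  have fin: "finite (map_prod Suc Suc ` D)" using finite_symmetric_diagram[OF D] by simp
  have disj: "principal_hook M \<inter> map_prod Suc Suc ` D = {}"
    using symmetric_diagrams_bound[OF D] by (auto simp: principal_hook_def)
  have inj: "inj_on (map_prod Suc Suc) D"
    by (rule inj_on_subset[OF prod.inj_map]) auto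
  show "card (add_hook M D) = 2 * M + 1 + card D"
    unfolding add_hook_def
    by (simp add: card_Un_disjoint[OF finite_principal_hook fin disj] card_principal_hook card_image[OF inj])
  have "diagram_rank w (map_prod Suc Suc ` D) = diagram_rank w D"
    unfolding diagram_rank_def by (subst sum.reindex[OF inj]) (auto intro: sum.cong)
  thus "diagram_rank w (add_hook M D) = hook_rank w (int M) + diagram_rank w D"
    unfolding diagram_rank_principal_hook[OF w, symmetric]
    by (simp add: add_hook_def diagram_rank_def sum.union_disjoint[OF finite_principal_hook fin disj])
qed

lemma rank_gf_0: "rank_gf w 0 z q = (if z = 0 then 1 else 0)"
proof -
  have "{D \<in> symmetric_diagrams 0. diagram_rank w D = z} = (if z = 0 then {{}} else {})"
    by (auto simp: symmetric_diagrams_def diagram_rank_def)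
  thus ?thesis by (simp add: rank_gf_def)
qed

lemma rank_gf_Suc:
  assumes w: "w \<noteq> 0" "w \<noteq> 1"
  shows "rank_gf w (Suc M) z q =
    rank_gf w M z q + q ^ (2 * M + 1) * rank_gf w M (z - hook_rank w (int M)) q"
proof -
  let ?U = "\<lambda>z. {D \<in> symmetric_diagrams M. diagram_rank w D = z}" and ?h = "hook_rank w (int M)"
  have eq: "{D \<in> symmetric_diagrams (Suc M). diagram_rank w D = z} = ?U z \<union> add_hook M ` ?U (z - ?h)"
    unfolding symmetric_diagrams_Suc by (auto simp: add_hook_stats[OF _ w])
  have inj: "inj_on (add_hook M) (?U (z - ?h))"
    by (rule inj_on_subset[OF inj_on_add_hook]) auto
  have "rank_gf w (Suc M) z q = rank_gf w M z q + (\<Sum>D\<in>add_hook M ` ?U (z - ?h). q ^ card D)"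
    unfolding rank_gf_def eq
    by (rule sum.union_disjoint) (use symmetric_diagrams_disjoint[of M] in \<open>auto simp: finite_symmetric_diagrams\<close>)
  also have "(\<Sum>D\<in>add_hook M ` ?U (z - ?h). q ^ card D) =
      q ^ (2 * M + 1) * rank_gf w M (z - ?h) q"
    unfolding rank_gf_def sum_distrib_left
    by (subst sum.reindex[OF inj]) (auto simp: add_hook_stats[OF _ w] power_add intro!: sum.cong)
  finally show ?thesis .
qed

section \<open>Pascal rules for q-binomial coefficients\<close>

lemma qpochhammer_Suc: "qpochhammer a q (Suc n) = qpochhammer a q n * (1 - a * q ^ n)"
  by (simp add: qpochhammer_def)

lemma fps_nth_qpochhammer_0:
  fixes Q :: "'a :: field fps"
  assumes "fps_nth Q 0 = 0"
  shows "fps_nth (qpochhammer Q Q n) 0 = 1"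
  by (induction n) (use assms in \<open>simp_all add: qpochhammer_def\<close>)

text \<open>The denominator has constant term 1 and is therefore a unit, so the division in the
  definition is exact.\<close>

lemma qbinomial_mult_denominator:
  fixes Q :: "'a :: field fps"
  assumes Q: "fps_nth Q 0 = 0"
  shows "qbinomial Q (int (i + j)) (int i) * (qpochhammer Q Q i * qpochhammer Q Q j) =
    qpochhammer Q Q (i + j)"
proof -
  have "fps_nth (qpochhammer Q Q i * qpochhammer Q Q j) 0 \<noteq> 0"
    by (simp add: fps_nth_qpochhammer_0[OF Q])
  moreover have "nat (int (i + j) - int i) = j" by simp
  ultimately show ?thesis
    by (simp add: qbinomial_def fps_divide_unit inverse_mult_eq_1 mult.assoc
        del: of_nat_add fps_mult_nth_0)
qed

lemma qbinomial_symmetric: "qbinomial q m (m - n) = qbinomial q m n"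
  by (simp add: qbinomial_def mult.commute)

lemma qbinomial_0:
  fixes Q :: "'a :: field fps"
  assumes Q: "fps_nth Q 0 = 0" and "m \<ge> 0"
  shows "qbinomial Q m 0 = 1"
proof -
  have "qpochhammer Q Q (nat m) \<noteq> 0"
    using fps_nth_qpochhammer_0[OF Q, of "nat m"] by auto
  moreover have "qpochhammer Q Q 0 = 1" by (simp add: qpochhammer_def)
  ultimately show ?thesis
    using qbinomial_mult_denominator[OF Q, of 0 "nat m"] \<open>m \<ge> 0\<close> by simp
qed

text \<open>For 0 < n \<le> m, clearing denominators reduces the rule to
  \<open>(1 - Q ^ b) + Q ^ b * (1 - Q ^ a) = 1 - Q ^ (a + b)\<close> with a = n and b = m + 1 - n.
  The function \<open>nat\<close> truncates the exponent only where the coefficient after it is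
  0.\<close>

lemma qbinomial_pascal:
  fixes Q :: "'a :: field fps"
  assumes Q: "fps_nth Q 0 = 0" and m: "m \<ge> 0"
  shows "qbinomial Q (m + 1) n =
    qbinomial Q m n + Q ^ nat (m + 1 - n) * qbinomial Q m (n - 1)"
proof -
  consider "n < 0" | "n > m + 1" | "n = 0" | "n = m + 1" | "0 < n" "n \<le> m" by linarith
  thus ?thesis
  proof cases
    case 3
    thus ?thesis using m by (simp add: qbinomial_0[OF Q]) (simp add: qbinomial_def)
  next
    case 4
    have "qbinomial Q (m + 1) (m + 1) = 1" "qbinomial Q m m = 1"
      using qbinomial_symmetric[of Q "m + 1" 0] qbinomial_symmetric[of Q m 0] m
      by (simp_all add: qbinomial_0[OF Q])
    moreover have "qbinomial Q m (m + 1) = 0" by (simp add: qbinomial_def)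
    ultimately show ?thesis using 4 by simp
  next
    case 5
    define i j where "i = nat (n - 1)" and "j = nat (m - n)"
    have n: "n = int (Suc i)" and mm: "m = int (Suc i + j)"
      using 5 by (auto simp: i_def j_def)
    let ?P = "qpochhammer Q Q" and ?d = "qpochhammer Q Q (Suc i) * qpochhammer Q Q (Suc j)"
    have 1: "qbinomial Q (m + 1) n * ?d = ?P (Suc i + Suc j)"
      using qbinomial_mult_denominator[OF Q, of "Suc i" "Suc j"] by (simp add: n mm algebra_simps)
    have 2: "qbinomial Q m n * (?P (Suc i) * ?P j) = ?P (Suc i + j)"
      using qbinomial_mult_denominator[OF Q, of "Suc i" j] by (simp add: n mm)
    have 3: "qbinomial Q m (n - 1) * (?P i * ?P (Suc j)) = ?P (Suc i + j)"
      using qbinomial_mult_denominator[OF Q, of i "Suc j"] by (simp add: n mm add_ac)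
    have Suc: "?P (Suc k) = ?P k * (1 - Q ^ Suc k)" for k
      by (simp add: qpochhammer_Suc)
    have e: "nat (m + 1 - n) = Suc j" by (simp add: n mm)
    have "(qbinomial Q m n + Q ^ nat (m + 1 - n) * qbinomial Q m (n - 1)) * ?d
        = (qbinomial Q m n * (?P (Suc i) * ?P j)) * (1 - Q ^ Suc j)
          + Q ^ Suc j * (1 - Q ^ Suc i) * (qbinomial Q m (n - 1) * (?P i * ?P (Suc j)))"
      unfolding e Suc[of j] Suc[of i] by (simp add: algebra_simps)
    also have "\<dots> = ?P (Suc i + j) * (1 - Q ^ Suc (Suc i + j))"
      unfolding 2 3 by (simp add: algebra_simps power_add)
    also have "\<dots> = qbinomial Q (m + 1) n * ?d"
      unfolding 1 by (simp add: Suc)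
    finally show ?thesis
      using fps_nth_qpochhammer_0[OF Q, of "Suc i"] fps_nth_qpochhammer_0[OF Q, of "Suc j"]
      by (metis mult_cancel_right fps_zero_nth mult_eq_0_iff zero_neq_one)
  qed (auto simp: qbinomial_def)
qed

text \<open>This is the first rule reflected by \<open>n \<mapsto> m + 1 - n\<close>.\<close>

lemma qbinomial_pascal':
  fixes Q :: "'a :: field fps"
  assumes Q: "fps_nth Q 0 = 0" and m: "m \<ge> 0"
  shows "qbinomial Q (m + 1) n = qbinomial Q m (n - 1) + Q ^ nat n * qbinomial Q m n"
proof -
  have "qbinomial Q (m + 1) n = qbinomial Q (m + 1) (m + 1 - n)"
    by (simp only: qbinomial_symmetric)
  also have "\<dots> = qbinomial Q m (m - (n - 1)) + Q ^ nat n * qbinomial Q m (m - n)"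
    by (subst qbinomial_pascal[OF assms]) (simp add: algebra_simps)
  finally show ?thesis by (simp only: qbinomial_symmetric)
qed

section \<open>Hook ranks and the product formula\<close>

lemma power_int_cong_root_of_unity:
  fixes w :: complex
  assumes "w ^ t = 1" "t > 0" "a mod int t = b mod int t"
  shows "w powi a = w powi b"
  using power_int_mod_period[OF assms(1,2)] assms(3) by metis

lemma hook_rank_mod:
  assumes "w ^ t = 1" "t > 0"
  shows "hook_rank w (int (a mod t)) = hook_rank w (int a)"
  unfolding hook_rank_def zmod_int
  by (intro arg_cong2[of _ _ _ _ "(/)"] arg_cong2[of _ _ _ _ "(-)"]
      power_int_cong_root_of_unity[OF assms]) (simp_all add: mod_simps)

text \<open>Modulo t the reflection is \<open>a \<mapsto> - 1 - a\<close>, which exchanges the two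
  powers in the numerator of \<open>hook_rank\<close>.\<close>

lemma hook_rank_reflect:
  assumes "w ^ t = 1" "t > 0" "r < t"
  shows "hook_rank w (int (t - 1 - r)) = - hook_rank w (int r)"
proof -
  have "w powi (int t - int r) = w powi (- int r)"
    by (rule power_int_cong_root_of_unity[OF assms(1,2)]) (simp add: mod_simps)
  moreover have "w powi (int r + 1 - int t) = w powi (int r + 1)"
    by (rule power_int_cong_root_of_unity[OF assms(1,2)]) (simp add: mod_simps)
  moreover have "int (t - 1 - r) + 1 = int t - int r" "- int (t - 1 - r) = int r + 1 - int t"
    using assms(3) by auto
  ultimately show ?thesis
    by (simp only: hook_rank_def minus_divide_left minus_diff_eq)
qed

lemma hook_rank_middle:
  assumes "w ^ (2 * h + 1) = 1"
  shows "hook_rank w (int h) = 0"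
  using hook_rank_reflect[OF assms, of h] by simp

text \<open>
  Multiplying the relation by \<open>(w - 1) w\<^bsup>h-1\<^esup>\<close> turns it into an integer polynomial in w with the
  exponents h + r and h - 1 - r, which are distinct and less than t - 1.
\<close>

lemma hook_rank_independent:
  fixes w :: complex and c :: "nat \<Rightarrow> int"
  assumes t: "prime t" "t = 2 * h + 1" and w: "w ^ t = 1" "w \<noteq> 1"
    and c: "(\<Sum>r<h. of_int (c r) * hook_rank w (int r)) = 0"
  shows "\<forall>r<h. c r = 0"
proof (cases "h = 0")
  case False
  define P where "P = (\<Sum>r<h. monom (c r) (h + r) - monom (c r) (h - 1 - r))"
  have w0: "w \<noteq> 0" using w t by (auto simp: power_0_left)
  have "int_poly_eval P w = (\<Sum>r<h. of_int (c r) * (w ^ (h + r) - w ^ (h - 1 - r)))"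
    by (simp add: P_def right_diff_distrib)
  also have "\<dots> = (\<Sum>r<h. w ^ (h - 1) * (w - 1) * (of_int (c r) * hook_rank w (int r)))"
  proof (rule sum.cong)
    fix r assume "r \<in> {..<h}"
    have "w ^ (h + r) = w powi (int (h - 1) + (int r + 1))"
      using False by (simp add: power_int_def nat_add_distrib of_nat_diff)
    also have "\<dots> = w ^ (h - 1) * w powi (int r + 1)"
      using w0 by (subst power_int_add) simp_all
    finally have 1: "w ^ (h + r) = w ^ (h - 1) * w powi (int r + 1)" .
    have "w ^ (h - 1 - r) = w powi (int (h - 1) + (- int r))"
      using \<open>r \<in> {..<h}\<close> by (simp add: power_int_def of_nat_diff nat_diff_distrib)
    also have "\<dots> = w ^ (h - 1) * w powi (- int r)"
      using w0 by (subst power_int_add) simp_all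
    finally have 2: "w ^ (h - 1 - r) = w ^ (h - 1) * w powi (- int r)" .
    show "of_int (c r) * (w ^ (h + r) - w ^ (h - 1 - r)) =
        w ^ (h - 1) * (w - 1) * (of_int (c r) * hook_rank w (int r))"
      unfolding 1 2 hook_rank_def using w by (simp add: field_simps)
  qed simp
  also have "\<dots> = 0" using c by (simp flip: sum_distrib_left)
  finally have "int_poly_eval P w = 0" .
  moreover have "degree P < t - 1"
  proof -
    \<comment> \<open>The largest exponent is h + (h - 1) = t - 2.\<close>
    have "degree P \<le> 2 * h - 1"
      unfolding P_def
      by (intro degree_sum_le degree_diff_le order.trans[OF degree_monom_le]) auto
    thus ?thesis using t False by simp
  qed
  ultimately have "P = 0" by (rule int_poly_eval_root_of_unity_eq_0[OF t(1) w])
  show ?thesis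
  proof safe
    fix r assume "r < h"
    \<comment> \<open>The exponents h - 1 - s all lie below h, and h + s differs from h + r unless s
      = r.\<close>
    have "coeff P (h + r) = (\<Sum>s<h. if s = r then c s else 0)"
      unfolding P_def coeff_sum by (rule sum.cong) auto
    also have "\<dots> = c r" using \<open>r < h\<close> by simp
    finally show "c r = 0" using \<open>P = 0\<close> by simp
  qed
qed simp

text \<open>The number of a < M with a mod t = r, for r < t.\<close>

definition residue_count :: "nat \<Rightarrow> nat \<Rightarrow> nat \<Rightarrow> nat" where
  "residue_count M t r = M div t + (if r < M mod t then 1 else 0)"

lemma residue_count_Suc:
  assumes "r < t"
  shows "residue_count (Suc M) t r = residue_count M t r + (if r = M mod t then 1 else 0)"
proof -
  have "M mod t < t" using assms by simp
  thus ?thesis using assms by (auto simp: residue_count_def div_Suc mod_Suc)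
qed

lemma residue_count_mod: "residue_count M t (M mod t) = M div t"
  by (simp add: residue_count_def)

text \<open>This is the least weight of a pair of sets with size difference k in the count below.
  For k \<ge> 0 it is the sum of 2(ti + r) + 1 over i < k, with B empty; for k < 0, A is empty and B
  consists of the -k smallest numbers of its class.\<close>

definition pair_exponent :: "nat \<Rightarrow> nat \<Rightarrow> int \<Rightarrow> int" where
  "pair_exponent t r k = int t * k\<^sup>2 - (int t - 1 - 2 * int r) * k"

lemma pair_exponent_nonneg:
  assumes "2 * r < t"
  shows "pair_exponent t r k \<ge> 0"
proof -
  have "0 \<le> int t - 1 - 2 * int r" "int t - 1 - 2 * int r \<le> int t" using assms by auto
  moreover have "k \<le> k\<^sup>2" "0 \<le> k\<^sup>2"
    by (cases "k \<le> 0"; simp add: power2_eq_square self_le_power mult_le_cancel_left1) simp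
  ultimately have "(int t - 1 - 2 * int r) * k \<le> int t * k\<^sup>2"
    by (meson mult_left_mono mult_right_mono order.trans)
  thus ?thesis by (simp add: pair_exponent_def)
qed

text \<open>
  This counts pairs of sets A and B with |A| - |B| = k, of numbers congruent to r and to t - 1 - r
  modulo t respectively, by the sum of 2a + 1 over their elements. The m smallest numbers of the
  first class and the n smallest of the second are available.
\<close>

definition pair_gf :: "nat \<Rightarrow> nat \<Rightarrow> nat \<Rightarrow> nat \<Rightarrow> int \<Rightarrow> 'a \<Rightarrow> 'a :: {comm_ring_1, inverse}" where
  "pair_gf t r m n k q =
     q ^ nat (pair_exponent t r k) * qbinomial (q ^ (2 * t)) (int m + int n) (int n + k)"

lemma pair_gf_0_0:
  fixes q :: "'a :: field fps"
  assumes "fps_nth q 0 = 0" "t > 0"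
  shows "pair_gf t r 0 0 k q = (if k = 0 then 1 else 0)"
proof (cases "k = 0")
  case True
  have "fps_nth (q ^ (2 * t)) 0 = 0" using assms by (simp add: fps_nth_power_0 power_0_left)
  thus ?thesis using True by (simp add: pair_gf_def pair_exponent_def qbinomial_0)
qed (auto simp: pair_gf_def qbinomial_def)

text \<open>The newly available number is tm + r. Putting it into A costs its weight and leaves
  difference k - 1 for the rest, which is the first Pascal rule.\<close>

lemma pair_gf_Suc_left:
  fixes q :: "'a :: field fps"
  assumes q: "fps_nth q 0 = 0" and r: "2 * r < t"
  shows "pair_gf t r (Suc m) n k q =
    pair_gf t r m n k q + q ^ (2 * (t * m + r) + 1) * pair_gf t r m n (k - 1) q"
proof -
  let ?Q = "q ^ (2 * t)" and ?e = "\<lambda>k. nat (pair_exponent t r k)"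
  let ?B = "qbinomial ?Q (int m + int n) (int n + (k - 1))"
  have Q: "fps_nth ?Q 0 = 0" using q r by (simp add: fps_nth_power_0 power_0_left)
  have "q ^ ?e k * (?Q ^ nat (int m + 1 - k) * ?B) = q ^ (2 * (t * m + r) + 1) * (q ^ ?e (k - 1) * ?B)"
  \<comment> \<open>For larger k the function \<open>nat\<close> would spoil the exponent identity,
    but then \<open>?B\<close> is 0.\<close>
  proof (cases "k \<le> int m + 1")
    case True
    have "int (?e k + 2 * t * nat (int m + 1 - k)) = int (2 * (t * m + r) + 1 + ?e (k - 1))"
      using True pair_exponent_nonneg[OF r, of k] pair_exponent_nonneg[OF r, of "k - 1"]
      by (simp add: pair_exponent_def algebra_simps power2_eq_square)
    hence "?e k + 2 * t * nat (int m + 1 - k) = 2 * (t * m + r) + 1 + ?e (k - 1)"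
      unfolding of_nat_eq_iff .
    thus ?thesis
      by (simp only: mult.assoc[symmetric] power_mult[symmetric] power_add[symmetric])
  next
    case False
    thus ?thesis by (simp add: qbinomial_def)
  qed
  moreover have "qbinomial ?Q (int (Suc m) + int n) (int n + k) =
      qbinomial ?Q (int m + int n) (int n + k) + ?Q ^ nat (int m + 1 - k) * ?B"
    using qbinomial_pascal[OF Q, of "int m + int n" "int n + k"]
    by (simp add: algebra_simps)
  ultimately show ?thesis
    by (simp only: pair_gf_def distrib_left)
qed

text \<open>The newly available number tn + (t - 1 - r) goes into B, leaving difference k + 1 for
  the rest; this is the second Pascal rule.\<close>

lemma pair_gf_Suc_right:
  fixes q :: "'a :: field fps"
  assumes q: "fps_nth q 0 = 0" and r: "2 * r < t"
  shows "pair_gf t r m (Suc n) k q =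
    pair_gf t r m n k q + q ^ (2 * (t * n + (t - 1 - r)) + 1) * pair_gf t r m n (k + 1) q"
proof -
  let ?Q = "q ^ (2 * t)" and ?e = "\<lambda>k. nat (pair_exponent t r k)"
  let ?B = "qbinomial ?Q (int m + int n) (int n + (k + 1))"
  have Q: "fps_nth ?Q 0 = 0" using q r by (simp add: fps_nth_power_0 power_0_left)
  have "q ^ ?e k * (?Q ^ nat (int n + 1 + k) * ?B) =
      q ^ (2 * (t * n + (t - 1 - r)) + 1) * (q ^ ?e (k + 1) * ?B)"
  proof (cases "0 \<le> int n + 1 + k")
    case True
    have "int (t - 1 - r) = int t - 1 - int r" using r by auto
    hence "int (?e k + 2 * t * nat (int n + 1 + k)) = int (2 * (t * n + (t - 1 - r)) + 1 + ?e (k + 1))"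
      using True pair_exponent_nonneg[OF r, of k] pair_exponent_nonneg[OF r, of "k + 1"]
      by (simp add: pair_exponent_def algebra_simps power2_eq_square)
    hence "?e k + 2 * t * nat (int n + 1 + k) = 2 * (t * n + (t - 1 - r)) + 1 + ?e (k + 1)"
      unfolding of_nat_eq_iff .
    thus ?thesis
      by (simp only: mult.assoc[symmetric] power_mult[symmetric] power_add[symmetric])
  next
    case False
    thus ?thesis by (simp add: qbinomial_def)
  qed
  moreover have "qbinomial ?Q (int m + int (Suc n)) (int (Suc n) + k) =
      qbinomial ?Q (int m + int n) (int n + k) + ?Q ^ nat (int n + 1 + k) * ?B"
    using qbinomial_pascal'[OF Q, of "int m + int n" "int n + 1 + k"]
    by (simp add: algebra_simps)
  ultimately show ?thesis
    by (simp only: pair_gf_def distrib_left)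
qed

text \<open>The induction runs over all coefficient vectors c at once, since each step compares c
  with a vector changed in one coordinate.\<close>

lemma rank_gf_eq_prod:
  fixes q :: "'a :: field fps" and w :: complex
  assumes t: "prime t" "t = 2 * h + 1" and w: "w ^ t = 1" "w \<noteq> 1" and q: "fps_nth q 0 = 0"
  shows "rank_gf w M (\<Sum>r<h. of_int (c r) * hook_rank w (int r)) q =
    qpochhammer (- (q ^ t)) (q ^ (2 * t)) (residue_count M t h) *
    (\<Prod>r<h. pair_gf t r (residue_count M t r) (residue_count M t (t - 1 - r)) (c r) q)"
    (is "rank_gf w M (?z c) q = ?L M * (\<Prod>r<h. ?p M c r)")
proof (induction M arbitrary: c)
  case 0
  have t0: "t > 0" using t(2) by simp
  have L: "?L 0 = 1" by (simp add: residue_count_def qpochhammer_def)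
  have p: "?p 0 c r = (if c r = 0 then 1 else 0)" for r
    by (simp add: residue_count_def pair_gf_0_0[OF q t0])
  show ?case
  proof (cases "\<forall>r<h. c r = 0")
    case True
    hence "(\<Prod>r<h. ?p 0 c r) = 1" unfolding p by simp
    thus ?thesis using True by (simp add: rank_gf_0 L)
  next
    case False
    \<comment> \<open>Linear independence is used here: the empty diagram, the only one for M = 0,
      has rank 0, and only c = 0 represents that value.\<close>
    hence "?z c \<noteq> 0" using hook_rank_independent[OF t w] by blast
    moreover have "(\<Prod>r<h. ?p 0 c r) = 0"
      unfolding p using False by (intro prod_zero) auto
    ultimately show ?thesis by (simp add: rank_gf_0)
  qed
next
  case (Suc M)
  have t0: "t > 0" using t(2) by simp
  have w0: "w \<noteq> 0" using w t0 by (auto simp: power_0_left)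
  have shift: "?z (c(s := c s + d)) = ?z c + of_int d * hook_rank w (int s)" if "s < h" for s d
  proof -
    have "?z (c(s := c s + d)) =
        (\<Sum>r<h. of_int (c r) * hook_rank w (int r) + (if r = s then of_int d * hook_rank w (int r) else 0))"
      by (rule sum.cong) (auto simp: distrib_right)
    thus ?thesis using that by (simp add: sum.distrib)
  qed
  have split: "(\<Prod>r<h. f r) = f s * (\<Prod>r\<in>{..<h} - {s}. f r)" if "s < h" for s and f :: "nat \<Rightarrow> 'a fps"
    using that by (simp add: prod.remove)
  define r where "r = M mod t"
  have r: "r < t" using t0 by (simp add: r_def)
  have M: "M = t * (M div t) + r" by (simp add: r_def)
  have rc: "residue_count (Suc M) t s = residue_count M t s + (if s = r then 1 else 0)" if "s < t" for s
    using residue_count_Suc[OF that] by (simp add: r_def)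
  have same: "?p M c s = ?p (Suc M) c s" if "s < h" "s \<noteq> r" "t - 1 - s \<noteq> r" for s
    using rc[of s] rc[of "t - 1 - s"] that t(2) by simp
  have rcr: "residue_count M t r = M div t" by (simp add: r_def residue_count_mod)
  have rank: "hook_rank w (int M) = hook_rank w (int r)"
    unfolding r_def by (rule hook_rank_mod[OF w(1) t0, symmetric])
  note step = rank_gf_Suc[OF w0 w(2), of M "?z c" q, unfolded rank]
  \<comment> \<open>The residue r of M decides which factor gains a number: the left class of a
    pair, the middle class, or the right class.\<close>
  consider "r < h" | "r = h" | "h < r" by linarith
  thus ?case
  proof cases
    case 1
    let ?c = "c(r := c r + (- 1))"
    have "?z c - hook_rank w (int r) = ?z ?c" using shift[OF 1, of "- 1"] by simp
    hence "rank_gf w (Suc M) (?z c) q =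
        ?L M * (\<Prod>s<h. ?p M c s) + q ^ (2 * M + 1) * (?L M * (\<Prod>s<h. ?p M ?c s))"
      using step Suc[of c] Suc[of ?c] by simp
    also have "\<dots> = ?L M * ((?p M c r + q ^ (2 * M + 1) * ?p M ?c r) * (\<Prod>s\<in>{..<h} - {r}. ?p M c s))"
      unfolding split[OF 1] by (simp add: algebra_simps)
    also have "?p M c r + q ^ (2 * M + 1) * ?p M ?c r = ?p (Suc M) c r"
    proof -
      have "residue_count (Suc M) t r = Suc (M div t)"
        "residue_count (Suc M) t (t - 1 - r) = residue_count M t (t - 1 - r)"
        using rc[OF r] rc[of "t - 1 - r"] 1 t(2) rcr by auto
      moreover have "2 * r < t" using 1 t(2) by simp
      ultimately show ?thesis
        using pair_gf_Suc_left[OF q, of r t "M div t" "residue_count M t (t - 1 - r)" "c r"]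
        by (simp add: rcr flip: M)
    qed
    also have "(\<Prod>s\<in>{..<h} - {r}. ?p M c s) = (\<Prod>s\<in>{..<h} - {r}. ?p (Suc M) c s)"
      by (rule prod.cong[OF refl], rule same) (use 1 t(2) in auto)
    also have "?L M = ?L (Suc M)" using 1 rc[of h] t(2) by simp
    finally show ?thesis unfolding split[OF 1] .
  next
    case 2
    have "hook_rank w (int r) = 0"
      unfolding 2 by (rule hook_rank_middle) (use w t(2) in simp)
    hence "rank_gf w (Suc M) (?z c) q = ?L M * (1 + q ^ (2 * M + 1)) * (\<Prod>s<h. ?p M c s)"
      using step Suc[of c] by (simp add: algebra_simps)
    also have "?L M * (1 + q ^ (2 * M + 1)) = ?L (Suc M)"
    proof -
      have "residue_count M t h = M div t" "residue_count (Suc M) t h = Suc (M div t)"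
        using rcr rc[OF r] 2 by simp_all
      \<comment> \<open>Here M = t(M div t) + h and 2h + 1 = t, so the hook of rank 0 supplies
        exactly the next q-Pochhammer factor.\<close>
      moreover have "2 * M + 1 = t + 2 * t * (M div t)"
        by (subst M, subst 2) (simp add: t(2))
      hence "q ^ (2 * M + 1) = q ^ t * (q ^ (2 * t)) ^ (M div t)"
        by (simp only: power_add power_mult)
      ultimately show ?thesis by (simp add: qpochhammer_Suc)
    qed
    also have "(\<Prod>s<h. ?p M c s) = (\<Prod>s<h. ?p (Suc M) c s)"
      by (rule prod.cong[OF refl], rule same) (use 2 t(2) in auto)
    finally show ?thesis .
  next
    case 3
    \<comment> \<open>The residue r is the right class of the pair indexed by s; its hook rank is
      minus that of s, so \<open>c s\<close> goes up by 1.\<close>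
    define s where "s = t - 1 - r"
    have s: "s < h" "r = t - 1 - s" "s < t" "s \<noteq> r" using 3 r t(2) by (auto simp: s_def)
    let ?c = "c(s := c s + 1)"
    have "hook_rank w (int r) = - hook_rank w (int s)"
      unfolding s(2) by (rule hook_rank_reflect[OF w(1) t0 s(3)])
    hence "?z c - hook_rank w (int r) = ?z ?c" using shift[OF s(1), of 1] by simp
    hence "rank_gf w (Suc M) (?z c) q =
        ?L M * (\<Prod>s<h. ?p M c s) + q ^ (2 * M + 1) * (?L M * (\<Prod>s<h. ?p M ?c s))"
      using step Suc[of c] Suc[of ?c] by simp
    also have "\<dots> = ?L M * ((?p M c s + q ^ (2 * M + 1) * ?p M ?c s) * (\<Prod>s\<in>{..<h} - {s}. ?p M c s))"
      unfolding split[OF s(1)] by (simp add: algebra_simps)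
    also have "?p M c s + q ^ (2 * M + 1) * ?p M ?c s = ?p (Suc M) c s"
    proof -
      have "residue_count (Suc M) t (t - 1 - s) = Suc (M div t)" "residue_count M t (t - 1 - s) = M div t"
        "residue_count (Suc M) t s = residue_count M t s"
        using rc[OF r] rc[of s] rcr s by auto
      moreover have "2 * s < t" using s(1) t(2) by simp
      moreover have "t * (M div t) + (t - 1 - s) = M" using M s(2) by simp
      ultimately show ?thesis
        using pair_gf_Suc_right[OF q, of s t "residue_count M t s" "M div t" "c s"] by simp
    qed
    also have "(\<Prod>s\<in>{..<h} - {s}. ?p M c s) = (\<Prod>s\<in>{..<h} - {s}. ?p (Suc M) c s)"
      by (rule prod.cong[OF refl], rule same) (use s 3 t(2) in auto)
    also have "?L M = ?L (Suc M)" using 3 rc[of h] t(2) by simp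
    finally show ?thesis unfolding split[OF s(1)] .
  qed
qed

section \<open>Ceilings, floors and the final formula\<close>

lemma ceiling_divide_eq_if:
  fixes x :: real
  assumes "- real t < x" "x \<le> real t"
  shows "\<lceil>x / real t\<rceil> = (if 0 < x then 1 else 0)"
  using assms by (auto simp: ceiling_eq_iff divide_simps)

lemma floor_divide_eq_if:
  fixes x :: real
  assumes "0 \<le> x" "x < 2 * real t"
  shows "\<lfloor>x / real t\<rfloor> = (if real t \<le> x then 1 else 0)"
  using assms by (auto simp: floor_eq_iff divide_simps)

theorem theorem1p3:
  fixes t N \<nu> :: nat and k :: int and q :: "rat fps"
  assumes "prime t" and "odd t"
    and "\<nu> \<in> {0..t - 1}"
    and "q = fps_X"
  shows "GSC (t * N + \<nu>) t k q =
    q ^ nat (int t * k\<^sup>2 - (int t - 1) * k)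
    * qpochhammer (- (q ^ t)) (q ^ (2 * t))
        (nat (int N + \<lceil>(real \<nu> - (real t - 1) / 2) / real t\<rceil>))
    * qbinomial (q ^ (2 * t)) (2 * int N + \<lceil>real \<nu> / real t\<rceil>) (int N + k)
    * (\<Prod>i = 1..(t - 3) div 2.
        qbinomial (q ^ (2 * t))
          (2 * int N + \<lceil>(real \<nu> - real i) / real t\<rceil> + \<lfloor>(real \<nu> + real i) / real t\<rfloor>)
          (int N + \<lfloor>(real \<nu> + real i) / real t\<rfloor>))"
proof -
  obtain h where h: "t = 2 * h + 1" using \<open>odd t\<close> by (elim oddE)
  have h0: "h > 0" using \<open>prime t\<close> h by (cases h) auto
  have \<nu>: "\<nu> < t" using assms(3) h by auto
  define w where "w = exp (2 * of_real pi * \<i> / of_nat t)"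
  have t0: "t > 0" using h by simp
  hence wt: "w ^ t = 1" by (simp add: w_def flip: exp_of_nat_mult)
  have w1: "w \<noteq> 1"
  proof
    assume "w = 1"
    moreover have "w = cis (2 * pi / real t)" by (simp add: w_def cis_conv_exp mult_ac)
    \<comment> \<open>As t \<ge> 3, the angle lies strictly between 0 and pi, so w has positive
      imaginary part.\<close>
    moreover have "0 < sin (2 * pi / real t)"
      using h h0 by (intro sin_gt_zero) (auto simp: field_simps)
    ultimately show False by (simp add: complex_eq_iff)
  qed
  \<comment> \<open>Since \<open>hook_rank w 0 = 1\<close>, the integer k is k times the first hook
    rank; only the pair {0, t - 1} carries k.\<close>
  let ?M = "t * N + \<nu>" and ?c = "\<lambda>r. if r = 0 then k else 0"
  have rc: "residue_count ?M t r = N + (if r < \<nu> then 1 else 0)" for r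
    using \<nu> by (simp add: residue_count_def)
  have "(\<Sum>r<h. of_int (?c r) * hook_rank w (int r)) = (\<Sum>r<h. if r = 0 then of_int k else 0)"
    by (rule sum.cong) (use w1 in \<open>auto simp: hook_rank_def\<close>)
  also have "\<dots> = of_int k" using h0 by simp
  finally have sum: "(\<Sum>r<h. of_int (?c r) * hook_rank w (int r)) = of_int k" .
  have "GSC ?M t k q = qpochhammer (- (q ^ t)) (q ^ (2 * t)) (residue_count ?M t h) *
      (\<Prod>r<h. pair_gf t r (residue_count ?M t r) (residue_count ?M t (t - 1 - r)) (?c r) q)"
    unfolding GSC_eq_rank_gf[OF t0 w_def] sum[symmetric]
    by (rule rank_gf_eq_prod[OF \<open>prime t\<close> h wt w1]) (simp add: assms(4))
  also have "{..<h} = insert 0 {1..(t - 3) div 2}" using h h0 by auto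
  also have "(\<Prod>r\<in>\<dots>. pair_gf t r (residue_count ?M t r) (residue_count ?M t (t - 1 - r)) (?c r) q) =
      pair_gf t 0 (residue_count ?M t 0) (residue_count ?M t (t - 1)) k q *
      (\<Prod>r=1..(t - 3) div 2. pair_gf t r (residue_count ?M t r) (residue_count ?M t (t - 1 - r)) 0 q)"
    by (subst prod.insert) (auto intro!: prod.cong)
  also have "residue_count ?M t h = nat (int N + \<lceil>(real \<nu> - (real t - 1) / 2) / real t\<rceil>)"
  proof -
    have "\<lceil>(real \<nu> - (real t - 1) / 2) / real t\<rceil> = (if h < \<nu> then 1 else 0)"
      using \<nu> h by (subst ceiling_divide_eq_if) auto
    thus ?thesis unfolding rc by (simp add: nat_add_distrib)
  qed
  \<comment> \<open>Residue 0 occurs N times plus once more if \<nu> > 0, while t - 1 occurs exactly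
    N times because \<nu> \<le> t - 1.\<close>
  also have "pair_gf t 0 (residue_count ?M t 0) (residue_count ?M t (t - 1)) k q =
      q ^ nat (int t * k\<^sup>2 - (int t - 1) * k) *
      qbinomial (q ^ (2 * t)) (2 * int N + \<lceil>real \<nu> / real t\<rceil>) (int N + k)"
    using \<nu> by (subst ceiling_divide_eq_if) (auto simp: rc pair_gf_def pair_exponent_def)
  also have "(\<Prod>r=1..(t - 3) div 2. pair_gf t r (residue_count ?M t r) (residue_count ?M t (t - 1 - r)) 0 q) =
      (\<Prod>i=1..(t - 3) div 2. qbinomial (q ^ (2 * t))
          (2 * int N + \<lceil>(real \<nu> - real i) / real t\<rceil> + \<lfloor>(real \<nu> + real i) / real t\<rfloor>)
          (int N + \<lfloor>(real \<nu> + real i) / real t\<rfloor>))"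
  proof (rule prod.cong)
    fix i assume "i \<in> {1..(t - 3) div 2}"
    hence i: "1 \<le> i" "i < h" using h by auto
    have "\<lceil>(real \<nu> - real i) / real t\<rceil> = (if i < \<nu> then 1 else 0)"
      using i h \<nu> by (subst ceiling_divide_eq_if) auto
    \<comment> \<open>The condition t \<le> \<nu> + i says that the residue t - 1 - i is below
      \<nu>, so the floor counts its extra occurrence.\<close>
    moreover have "\<lfloor>(real \<nu> + real i) / real t\<rfloor> = (if t - 1 - i < \<nu> then 1 else 0)"
      using i h \<nu> by (subst floor_divide_eq_if) auto
    ultimately show "pair_gf t i (residue_count ?M t i) (residue_count ?M t (t - 1 - i)) 0 q =
        qbinomial (q ^ (2 * t))
          (2 * int N + \<lceil>(real \<nu> - real i) / real t\<rceil> + \<lfloor>(real \<nu> + real i) / real t\<rfloor>)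
          (int N + \<lfloor>(real \<nu> + real i) / real t\<rfloor>)"
      unfolding rc by (simp add: pair_gf_def pair_exponent_def add_ac)
  qed simp
  finally show ?thesis by (simp only: mult_ac)
qed

end
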